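(* For every integer $n\ge 1$ let $C_n(q)$ be the polynomial defined below and write $$C_n(q)=c_{n,0}\,q^n+\sum_{i=1}^{n} c_{n,i}\,(q^{n+i}+q^{n-i})$$ with integers $c_{n,i}$ ($0\le i\le n$). Then: (a) $c_{n,0}=2(-1)^k$ if $n=k(k+1)/2$ for some integer $k\ge 1$, and $c_{n,0}=0$ otherwise. (b) For $1\le i\le n$: $$c_{n,i}=\begin{cases}(-1)^k & \text{if } n=k(k+2i+1)/2 \text{ for some integer } k\ge1,\\ (-1)^{k-1} & \text{if } n=k(k+2i-1)/2 \text{ for some integer } k\ge 1,\\ 0 & \text{otherwise.}\end{cases}$$
   Context: For each integer $n\ge1$, the Laurent polynomial $C_n(q)$ is defined by the identity of formal power series in $t$ $$1+\sum_{n\ge1}\frac{C_n(q)}{q^n}t^n=\prod_{i\ge1}\frac{(1-t^i)^2}{1-(q+q^{-1})t^i+t^{2i}}.$$ It is known that $C_n(q)$ is a monic polynomial in $q$ with integer coefficients of degree $2n$ (it equals the number of ideals of codimension $n$ of $\mathbb{F}_q[x,y,x^{-1},y^{-1}]$ when $q$ is a prime power), and it is palindromic, i.e. $C_n(q)=q^{2n}C_n(q^{-1})$, which is why it can be written in the displayed form. *)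

theory Defs
  imports "HOL-Analysis.Infinite_Products" "HOL-Computational_Algebra.Formal_Laurent_Series"
begin

(* Laurent polynomials in q are represented inside the field of formal Laurent series
   over the rationals, with q = fls_X; power series in t are formal power series over
   that field, with t = fps_X. *)

abbreviation q :: "rat fls" where "q \<equiv> fls_X"

definition C_factor :: "nat \<Rightarrow> rat fls fps" where
  "C_factor i = (1 - fps_X ^ i)\<^sup>2
     / (1 - fps_const (q + inverse q) * fps_X ^ i + fps_X ^ (2 * i))"

(* prodinf is taken with respect to the t-adic topology on formal power series and ranges
   over i >= 0, hence the shift of the index; it converges by C_factor_has_prod. *)
definition C_series :: "rat fls fps" where
  "C_series = (\<Prod>i. C_factor (Suc i))"

(* The generating identity defining C is C_generating_identity. *)
definition C :: "nat \<Rightarrow> rat fls" where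
  "C n = q ^ n * fps_nth C_series n"

lemma C_factor_nth:
  assumes "k \<le> i"
  shows "fps_nth (C_factor (Suc i)) k = (if k = 0 then 1 else 0)"
proof -
  define T where "T = (fps_X ^ Suc i :: rat fls fps)"
  define d where "d = 1 - fps_const (q + inverse q) * T + T\<^sup>2"
  define g where "g = fps_const (q + inverse q) - 2"
  have d0: "fps_nth d 0 = 1" by (simp add: d_def T_def power2_eq_square)
  have num: "(1 - T)\<^sup>2 = d + g * T"
    by (simp add: g_def d_def power2_eq_square algebra_simps)
  have T2: "fps_X ^ (2 * Suc i) = T\<^sup>2"
    unfolding T_def by (metis power_mult mult.commute)
  have "C_factor (Suc i) = (1 - T)\<^sup>2 / d"
    unfolding C_factor_def T2 d_def T_def ..
  also have "\<dots> = (d + g * T) * inverse d"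
    unfolding num by (rule fps_divide_unit) (simp add: d0)
  also have "\<dots> = 1 + T * (g * inverse d)"
    using inverse_mult_eq_1'[of d] d0 by (simp add: algebra_simps)
  finally show ?thesis
    using assms by (simp add: T_def fps_X_power_mult_nth del: power_Suc)
qed

lemma fps_nth_prod_C_factor:
  assumes "n \<le> N"
  shows "fps_nth (\<Prod>i\<le>N. C_factor (Suc i)) n = fps_nth (\<Prod>i\<le>n. C_factor (Suc i)) n"
  using assms
proof (induction N rule: dec_induct)
  case (step N)
  have "fps_nth ((\<Prod>i\<le>N. C_factor (Suc i)) * C_factor (Suc (Suc N))) n
      = (\<Sum>j=0..n. fps_nth (\<Prod>i\<le>N. C_factor (Suc i)) j * (if n - j = 0 then 1 else 0))"
    unfolding fps_mult_nth using step.hyps by (intro sum.cong refl) (simp add: C_factor_nth)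
  also have "\<dots> = (\<Sum>j=0..n. if j = n then fps_nth (\<Prod>i\<le>N. C_factor (Suc i)) j else 0)"
    by (intro sum.cong refl) auto
  also have "\<dots> = fps_nth (\<Prod>i\<le>N. C_factor (Suc i)) n" by simp
  finally show ?case using step.IH by simp
qed auto

lemma
  C_factor_has_prod: "(\<lambda>i. C_factor (Suc i)) has_prod C_series" and
  C_series_nth: "fps_nth C_series n = fps_nth (\<Prod>i\<le>n. C_factor (Suc i)) n"
proof -
  define p where "p = Abs_fps (\<lambda>n. fps_nth (\<Prod>i\<le>n. C_factor (Suc i)) n)"
  have "(\<lambda>N. \<Prod>i\<le>N. C_factor (Suc i)) \<longlonglongrightarrow> p"
  proof (rule tendsto_fpsI)
    fix m
    show "\<forall>\<^sub>F N in sequentially. fps_nth (\<Prod>i\<le>N. C_factor (Suc i)) m = fps_nth p m"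
      by (rule eventually_sequentiallyI[of m])
         (simp only: p_def fps_nth_Abs_fps, rule fps_nth_prod_C_factor)
  qed
  moreover have "fps_nth p 0 = 1" by (simp add: p_def C_factor_nth)
  ultimately have has: "(\<lambda>i. C_factor (Suc i)) has_prod p"
    unfolding has_prod_def raw_has_prod_def by auto
  have p: "C_series = p"
    unfolding C_series_def using has_prod_unique[OF has] by simp
  show "(\<lambda>i. C_factor (Suc i)) has_prod C_series" using has p by simp
  show "fps_nth C_series n = fps_nth (\<Prod>i\<le>n. C_factor (Suc i)) n"
    unfolding p by (simp add: p_def)
qed

lemma C_generating_identity:
  "Abs_fps (\<lambda>n. if n = 0 then 1 else C n / q ^ n) = (\<Prod>i. C_factor (Suc i))"
proof (rule fps_ext)
  fix n
  have "C n / q ^ n = fps_nth C_series n"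
    unfolding C_def by (rule nonzero_mult_div_cancel_left) simp
  moreover have "fps_nth C_series 0 = 1"
    by (simp add: C_series_nth C_factor_nth)
  ultimately show "fps_nth (Abs_fps (\<lambda>n. if n = 0 then 1 else C n / q ^ n)) n
      = fps_nth (\<Prod>i. C_factor (Suc i)) n"
    unfolding C_series_def [symmetric] by simp
qed

end

theory Submission
  imports Defs "HOL-Library.Nat_Bijection"
begin

text \<open>
  Put \<open>(t)\<^sub>N = (1 - t) \<dots> (1 - t\<^sup>N)\<close> and \<open>c = q + 1/q\<close>. The finite product over \<open>i \<le> N\<close> has the
  partial fraction decomposition
  \<open>1 + (2 - c) \<Sum> (-1)\<^sup>n t^(n(n+1)/2) (1 + t\<^sup>n) A(N,n) / (1 - c t\<^sup>n + t^(2n))\<close>, summed over \<open>1 \<le> n \<le> N\<close>,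
  where \<open>A(N,n) = (t)\<^sub>N\<^sup>2 / ((t)\<^bsub>N-n\<^esub> (t)\<^bsub>N+n\<^esub>)\<close>; passing from \<open>N\<close> to \<open>N + 1\<close> needs only the vanishing of an
  alternating sum of q-binomial coefficients, which telescopes. Since \<open>A(N,n) = 1 + O(t^(N-n+1))\<close>
  is multiplied by \<open>t^(n(n+1)/2)\<close>, it does not affect the coefficients up to \<open>t\<^sup>N\<close>. There, the identity
  \<open>(2 - c)(1 + t\<^sup>n) / (1 - c t\<^sup>n + t^(2n)) = (1 - q)/(1 - q t\<^sup>n) + (1 - 1/q)/(1 - t\<^sup>n/q)\<close>
  and the geometric series express \<open>C\<^sub>m\<close> through the solutions of \<open>m = n(n+1)/2 + n j\<close>.
\<close>

section \<open>Finite Euler products and their quotients\<close>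

definition euler_prod :: "'a::comm_ring_1 \<Rightarrow> nat \<Rightarrow> 'a" where
  "euler_prod t n = (\<Prod>i=1..n. 1 - t ^ i)"

lemma euler_prod_0 [simp]: "euler_prod t 0 = 1"
  by (simp add: euler_prod_def)

lemma euler_prod_Suc: "euler_prod t (Suc n) = euler_prod t n * (1 - t ^ Suc n)"
  by (simp add: euler_prod_def)

lemma euler_prod_nonzero:
  fixes t :: "'a::idom"
  assumes "\<And>i. i \<ge> 1 \<Longrightarrow> t ^ i \<noteq> 1"
  shows "euler_prod t n \<noteq> 0"
  using assms by (fastforce simp: euler_prod_def)

text \<open>This is A(N,n), the quotient of the q-binomial coefficients [2N, N-n] and [2N, N]. The
  class \<open>idom_divide\<close> covers both the fields in which the identities are derived and
  the power series ring in which they are applied.\<close>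

definition euler_ratio :: "'a::idom_divide \<Rightarrow> nat \<Rightarrow> nat \<Rightarrow> 'a" where
  "euler_ratio t N n = (euler_prod t N)\<^sup>2 div (euler_prod t (N - n) * euler_prod t (N + n))"

lemma euler_ratio_0 [simp]:
  fixes t :: "'a::field"
  assumes "\<And>i. i \<ge> 1 \<Longrightarrow> t ^ i \<noteq> 1"
  shows "euler_ratio t N 0 = 1"
  using euler_prod_nonzero[of t N, OF assms] by (simp add: euler_ratio_def power2_eq_square)

lemma euler_ratio_Suc_right:
  fixes t :: "'a::field"
  assumes "\<And>i. i \<ge> 1 \<Longrightarrow> t ^ i \<noteq> 1" and "n < N"
  shows "euler_ratio t N n * (1 - t ^ (N - n)) = euler_ratio t N (Suc n) * (1 - t ^ Suc (N + n))"
proof -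
  obtain m where N: "N = Suc m + n" using assms(2) by (metis less_imp_Suc_add add.commute add_Suc)
  have "1 - t ^ Suc (N + n) \<noteq> 0" "1 - t ^ Suc m \<noteq> 0"
    using assms(1)[of "Suc (N + n)"] assms(1)[of "Suc m"] by auto
  moreover have "euler_prod t (N - n) = euler_prod t m * (1 - t ^ Suc m)" "N - Suc n = m"
    using N by (simp_all add: euler_prod_Suc del: power_Suc)
  moreover have "euler_prod t (N + Suc n) = euler_prod t (N + n) * (1 - t ^ Suc (N + n))"
    by (simp add: euler_prod_Suc del: power_Suc)
  moreover have "N - n = Suc m" using N by simp
  ultimately show ?thesis
    by (simp add: euler_ratio_def del: power_Suc)
qed

text \<open>Drives the induction on N: the two factors on the right are the numerator that
  \<open>partial_fraction_split\<close> takes apart.\<close>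

lemma euler_ratio_Suc_left:
  fixes t :: "'a::field"
  assumes "\<And>i. i \<ge> 1 \<Longrightarrow> t ^ i \<noteq> 1" and "n \<le> N"
  shows "euler_ratio t N n * (1 - t ^ Suc N)\<^sup>2
       = euler_ratio t (Suc N) n * ((1 - t ^ (Suc N - n)) * (1 - t ^ (Suc N + n)))"
proof -
  have "1 - t ^ (Suc N + n) \<noteq> 0" "1 - t ^ (Suc N - n) \<noteq> 0"
    using assms(1)[of "Suc N + n"] assms(1)[of "Suc N - n"] assms(2) by auto
  moreover have "euler_prod t (Suc N - n) = euler_prod t (N - n) * (1 - t ^ (Suc N - n))"
    using assms(2) by (simp add: Suc_diff_le euler_prod_Suc del: power_Suc)
  moreover have "euler_prod t (Suc N + n) = euler_prod t (N + n) * (1 - t ^ (Suc N + n))"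
    by (simp add: euler_prod_Suc del: power_Suc)
  ultimately show ?thesis
    by (simp add: euler_ratio_def euler_prod_Suc power_mult_distrib del: power_Suc)
qed

text \<open>A telescoping closed form for the partial sums. At j = M the factor 1 - t^(M-j) is zero,
  so the full sum vanishes; pairing n with -n, this is the vanishing of the sum of (-1)^n
  t^(n(n-1)/2) [2M, M+n] over -M \<le> n \<le> M, divided by [2M, M].\<close>

lemma sum_alternating_euler_ratio:
  fixes t :: "'a::field"
  assumes t: "\<And>i. i \<ge> 1 \<Longrightarrow> t ^ i \<noteq> 1" and "j \<le> M" "M \<ge> 1"
  shows "(1 - t ^ M) * (1 + (\<Sum>n=1..j. (-1) ^ n * t ^ triangle (n - 1) * (1 + t ^ n) * euler_ratio t M n))
       = (-1) ^ j * t ^ triangle j * (1 - t ^ (M - j)) * euler_ratio t M j"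
  using \<open>j \<le> M\<close>
proof (induction j)
  case 0
  show ?case by (simp add: t)
next
  case (Suc j)
  define R where "R = euler_ratio t M (Suc j)"
  define x where "x = t ^ Suc j"
  define y where "y = t ^ (M - Suc j)"
  \<comment> \<open>In terms of x and y the induction step is (1 - y x^2) - (1 - y x)(1 + x) = -x (1
    - y).\<close>
  have yx: "t ^ M = y * x" "t ^ Suc (M + j) = y * x * x"
    using Suc.prems unfolding x_def y_def by (simp_all add: power_add [symmetric] del: power_Suc)
  have "(1 - t ^ M) * (1 + (\<Sum>n=1..Suc j. (-1) ^ n * t ^ triangle (n - 1) * (1 + t ^ n) * euler_ratio t M n))
      = (-1) ^ j * t ^ triangle j * (euler_ratio t M j * (1 - t ^ (M - j)))
        + (1 - t ^ M) * ((-1) ^ Suc j * t ^ triangle j * (1 + t ^ Suc j) * R)"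
    using Suc by (simp add: R_def distrib_left mult_ac add.assoc [symmetric] del: power_Suc)
  also have "euler_ratio t M j * (1 - t ^ (M - j)) = R * (1 - t ^ Suc (M + j))"
    unfolding R_def using Suc.prems by (intro euler_ratio_Suc_right t) auto
  also have "(-1) ^ j * t ^ triangle j * (R * (1 - t ^ Suc (M + j)))
        + (1 - t ^ M) * ((-1) ^ Suc j * t ^ triangle j * (1 + t ^ Suc j) * R)
      = (-1) ^ Suc j * (t ^ triangle j * x) * (1 - y) * R"
    unfolding yx x_def [symmetric] by (simp add: algebra_simps)
  also have "t ^ triangle j * x = t ^ triangle (Suc j)"
    by (simp add: x_def power_add)
  finally show ?case
    by (simp only: y_def R_def)
qed

section \<open>Partial fractions of the finite product\<close>

text \<open>In D M - t^(M-n) D n the terms with c cancel, and what remains factors as the numerator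
  on the left.\<close>

lemma partial_fraction_split:
  fixes t c :: "'a::field"
  defines "D \<equiv> \<lambda>i. 1 - c * t ^ i + t ^ (2 * i)"
  assumes "n \<le> M" "D n \<noteq> 0" "D M \<noteq> 0"
  shows "(1 - t ^ (M - n)) * (1 - t ^ (M + n)) / (D n * D M) = 1 / D n - t ^ (M - n) / D M"
proof -
  define x where "x = t ^ n"
  define y where "y = t ^ (M - n)"
  have yx: "t ^ M = y * x" "t ^ (M + n) = y * x * x" "t ^ (2 * M) = (y * x)\<^sup>2" "t ^ (2 * n) = x\<^sup>2"
    using assms(2) unfolding x_def y_def
    by (simp_all add: power_add [symmetric] power_mult [symmetric] mult.commute)
  have "(1 - t ^ (M - n)) * (1 - t ^ (M + n)) = D M - t ^ (M - n) * D n"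
    unfolding D_def yx x_def [symmetric] y_def [symmetric] by (simp add: algebra_simps power2_eq_square)
  then show ?thesis using assms(3,4) by (simp add: diff_divide_distrib)
qed

lemma prod_partial_fractions:
  fixes t c :: "'a::field"
  defines "D \<equiv> \<lambda>i. 1 - c * t ^ i + t ^ (2 * i)"
  assumes t: "\<And>i. i \<ge> 1 \<Longrightarrow> t ^ i \<noteq> 1" and D: "\<And>i. i \<ge> 1 \<Longrightarrow> D i \<noteq> 0"
  shows "(\<Prod>i=1..N. (1 - t ^ i)\<^sup>2 / D i)
       = 1 + (2 - c) * (\<Sum>n=1..N. (-1) ^ n * t ^ triangle n * (1 + t ^ n) * euler_ratio t N n / D n)"
proof (induction N)
  case (Suc N)
  define M where "M = Suc N"
  define E where "E = (\<lambda>N n. (-1) ^ n * t ^ triangle n * (1 + t ^ n) * euler_ratio t N n)"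
  define E' where "E' = (\<lambda>n. (-1) ^ n * t ^ triangle (n - 1) * (1 + t ^ n) * euler_ratio t M n)"
  \<comment> \<open>The remainders that pile up over \<open>D M\<close> have weights t^(M-n); this
    turns their sum into t^M times the alternating sum that telescopes.\<close>
  have E'E: "E M n * t ^ (M - n) = t ^ M * E' n" if n: "n \<in> {1..M}" for n
  proof -
    obtain k where k: "n = Suc k" using n by (cases n) auto
    have "t ^ M = t ^ n * t ^ (M - n)" using n by (simp add: power_add [symmetric])
    moreover have "t ^ triangle n = t ^ triangle (n - 1) * t ^ n"
      unfolding k by (simp add: power_add)
    ultimately show ?thesis
      by (simp add: E_def E'_def mult_ac)
  qed
  have "(1 - t ^ M) * (1 + (\<Sum>n=1..M. E' n)) = 0"
    unfolding E'_def by (subst sum_alternating_euler_ratio) (auto simp: t M_def)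
  moreover have "t ^ M \<noteq> 1" using t[of M] by (simp add: M_def)
  ultimately have "1 + (\<Sum>n=1..M. E' n) = 0" by simp
  moreover have "(\<Sum>n=1..M. E M n * t ^ (M - n)) = t ^ M * (\<Sum>n=1..M. E' n)"
    unfolding sum_distrib_left by (rule sum.cong [OF refl E'E])
  ultimately have "t ^ M + (\<Sum>n=1..M. E M n * t ^ (M - n)) = 0"
    by (metis mult_zero_right distrib_left mult.right_neutral)
  \<comment> \<open>Isolating n = M shows that the new numerator over \<open>D M\<close> is exactly
    what the step from N to M leaves there.\<close>
  then have last: "E M M = - (t ^ M) - (\<Sum>n=1..N. E M n * t ^ (M - n))"
    by (simp add: M_def algebra_simps eq_neg_iff_add_eq_0)
  \<comment> \<open>The new factor upgrades A(N,n) to A(M,n) over the old denominator and sends the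
    rest to \<open>D M\<close>.\<close>
  have step: "E N n / D n * ((1 - t ^ M)\<^sup>2 / D M) = E M n / D n - E M n * t ^ (M - n) / D M"
    if n: "n \<in> {1..N}" for n
  proof -
    have "E N n * (1 - t ^ M)\<^sup>2 = E M n * ((1 - t ^ (M - n)) * (1 - t ^ (M + n)))"
      using euler_ratio_Suc_left[of t n N, OF t] n by (simp add: E_def M_def mult.assoc)
    then have "E N n / D n * ((1 - t ^ M)\<^sup>2 / D M)
        = E M n * ((1 - t ^ (M - n)) * (1 - t ^ (M + n)) / (D n * D M))" by simp
    also have "\<dots> = E M n * (1 / D n - t ^ (M - n) / D M)"
      using n D[of n] D[of M] unfolding D_def by (subst partial_fraction_split) (auto simp: M_def)
    finally show ?thesis by (simp add: algebra_simps)
  qed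
  have DM: "D M \<noteq> 0" using D[of M] by (simp add: M_def)
  have "(1 - t ^ M)\<^sup>2 = D M - (2 - c) * t ^ M"
    by (simp add: D_def power_even_eq) (simp add: power2_eq_square algebra_simps)
  then have one: "(1 - t ^ M)\<^sup>2 / D M = 1 - (2 - c) * (t ^ M / D M)"
    using DM by (simp add: diff_divide_distrib)
  have "(\<Prod>i=1..Suc N. (1 - t ^ i)\<^sup>2 / D i)
      = (1 + (2 - c) * (\<Sum>n=1..N. E N n / D n)) * ((1 - t ^ M)\<^sup>2 / D M)"
    using Suc by (simp add: E_def M_def)
  also have "\<dots> = (1 - t ^ M)\<^sup>2 / D M + (2 - c) * (\<Sum>n=1..N. E N n / D n * ((1 - t ^ M)\<^sup>2 / D M))"
    by (simp only: distrib_right sum_distrib_right mult.assoc mult_1_left)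
  also have "(\<Sum>n=1..N. E N n / D n * ((1 - t ^ M)\<^sup>2 / D M))
      = (\<Sum>n=1..N. E M n / D n - E M n * t ^ (M - n) / D M)"
    by (intro sum.cong refl step)
  also have "\<dots> = (\<Sum>n=1..N. E M n / D n) - (\<Sum>n=1..N. E M n * t ^ (M - n)) / D M"
    by (simp add: sum_subtractf sum_divide_distrib)
  also have "(1 - t ^ M)\<^sup>2 / D M + (2 - c) * \<dots>
      = 1 + (2 - c) * ((\<Sum>n=1..N. E M n / D n) + E M M / D M)"
    unfolding one last by (simp add: diff_divide_distrib algebra_simps)
  finally show ?case by (simp add: E_def M_def)
qed simp

section \<open>Transfer to formal power series in t\<close>

lemma fps_to_fls_sum: "fps_to_fls (sum f A) = (\<Sum>x\<in>A. fps_to_fls (f x))"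
  by (induction A rule: infinite_finite_induct) simp_all

lemma fps_to_fls_prod:
  "fps_to_fls (prod f A) = (\<Prod>x\<in>A. fps_to_fls (f x :: 'a::comm_ring_1 fps))"
  by (induction A rule: infinite_finite_induct) (simp_all add: fls_times_fps_to_fls)

lemma fps_to_fls_divide_unit:
  fixes f g :: "'a::field fps"
  assumes "fps_nth g 0 \<noteq> 0"
  shows "fps_to_fls (f / g) = fps_to_fls f / fps_to_fls g"
  using assms by (intro fls_divide_fps_to_fls [symmetric]) (simp add: subdegree_eq_0)

lemma euler_prod_X_nth_0: "fps_nth (euler_prod (fps_X :: 'a::field fps) n) 0 = 1"
  by (induction n) (simp_all add: euler_prod_Suc)

lemma fps_to_fls_euler_prod: "fps_to_fls (euler_prod f n) = euler_prod (fps_to_fls f) n"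
  by (simp add: euler_prod_def fps_to_fls_prod fps_to_fls_power)

lemma fps_to_fls_euler_ratio:
  "fps_to_fls (euler_ratio (fps_X :: 'a::field fps) N n) = euler_ratio fls_X N n"
  by (simp add: euler_ratio_def fps_to_fls_divide_unit euler_prod_X_nth_0 fls_times_fps_to_fls
      fps_to_fls_power fps_to_fls_euler_prod)

text \<open>Power series do not form a field, so the identity is taken in the Laurent series in t,
  where no t^i with i \<ge> 1 is 1 and no denominator vanishes. It descends because the embedding is
  injective and all divisors here are units of the power series ring.\<close>

lemma prod_partial_fractions_fps:
  fixes c :: "'a::field"
  defines "D \<equiv> \<lambda>i. 1 - fps_const c * fps_X ^ i + fps_X ^ (2 * i)"
  shows "(\<Prod>i=1..N. (1 - fps_X ^ i)\<^sup>2 / D i)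
       = 1 + fps_const (2 - c) * (\<Sum>n=1..N. (-1) ^ n * fps_X ^ triangle n * (1 + fps_X ^ n)
              * euler_ratio fps_X N n / D n)"
    (is "?lhs = ?rhs")
proof -
  have D0: "fps_nth (D i) 0 = 1" if "i \<ge> 1" for i
    using that by (simp add: D_def)
  define D' where "D' = (\<lambda>i. 1 - fls_const c * fls_X ^ i + fls_X ^ (2 * i))"
  have D': "fps_to_fls (D i) = D' i" for i
    by (simp add: D_def D'_def fls_times_fps_to_fls fps_to_fls_power)
  have nz: "D' i \<noteq> 0" if "i \<ge> 1" for i
    using D0[OF that] unfolding D' [symmetric] by (metis fps_to_fls_eq_0_iff fps_zero_nth zero_neq_one)
  have t: "(fls_X :: 'a fls) ^ i \<noteq> 1" if "i \<ge> 1" for i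
  proof
    assume "(fls_X :: 'a fls) ^ i = 1"
    then have "fls_nth ((fls_X :: 'a fls) ^ i) 0 = fls_nth 1 0" by simp
    with that show False by simp
  qed
  have "fps_to_fls ?lhs = (\<Prod>i=1..N. (1 - fls_X ^ i)\<^sup>2 / D' i)"
    unfolding fps_to_fls_prod
    by (intro prod.cong refl) (simp add: fps_to_fls_divide_unit D0 D' fps_to_fls_power)
  also have "\<dots> = 1 + (2 - fls_const c) * (\<Sum>n=1..N. (-1) ^ n * fls_X ^ triangle n * (1 + fls_X ^ n)
              * euler_ratio fls_X N n / D' n)"
    unfolding D'_def by (rule prod_partial_fractions) (use t nz in \<open>auto simp: D'_def\<close>)
  also have "\<dots> = fps_to_fls ?rhs"
  proof -
    have "fps_to_fls (\<Sum>n=1..N. (-1) ^ n * fps_X ^ triangle n * (1 + fps_X ^ n)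
              * euler_ratio fps_X N n / D n)
        = (\<Sum>n=1..N. (-1) ^ n * fls_X ^ triangle n * (1 + fls_X ^ n)
              * euler_ratio fls_X N n / D' n)"
      unfolding fps_to_fls_sum
      by (intro sum.cong refl)
         (simp add: fps_to_fls_divide_unit D0 D' fps_to_fls_power fls_times_fps_to_fls fps_to_fls_euler_ratio)
    moreover have "fps_to_fls (fps_const (2 - c)) = 2 - fls_const c"
      by (simp add: fps_const_sub [symmetric] numeral_fps_const [symmetric] del: fps_const_sub)
    ultimately show ?thesis by (simp add: fls_times_fps_to_fls)
  qed
  finally show ?thesis by (simp only: fps_to_fls_eq_iff)
qed

section \<open>Coefficients of the product up to t^N\<close>

text \<open>Every additional factor 1 - t^i has i > a, hence is 1 modulo t^(a+1).\<close>

lemma power_dvd_euler_prod_diff: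
  fixes a b :: nat
  assumes "a \<le> b"
  shows "t ^ Suc a dvd euler_prod t b - euler_prod t a"
  using assms
proof (induction b rule: dec_induct)
  case (step b)
  have "t ^ Suc a dvd t ^ Suc b" using step by (intro le_imp_power_dvd) simp
  moreover have "euler_prod t (Suc b) - euler_prod t a
      = (euler_prod t b - euler_prod t a) - euler_prod t b * t ^ Suc b"
    by (simp add: euler_prod_Suc algebra_simps del: power_Suc)
  ultimately show ?case using step.IH by (metis dvd_diff dvd_mult)
qed simp

text \<open>Modulo t^(N-n+1) both factors of the denominator agree with (t)_N, and the denominator
  is a unit.\<close>

lemma X_power_dvd_euler_ratio_minus_1:
  assumes "n \<le> N"
  shows "fps_X ^ Suc (N - n) dvd euler_ratio (fps_X :: 'a::field fps) N n - 1"
proof -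
  let ?p = "euler_prod (fps_X :: 'a fps)"
  let ?d = "?p (N - n) * ?p (N + n)"
  have d0: "fps_nth ?d 0 = 1" by (simp add: euler_prod_X_nth_0)
  have "euler_ratio (fps_X :: 'a fps) N n = (?p N)\<^sup>2 * inverse ?d"
    unfolding euler_ratio_def by (rule fps_divide_unit) (simp only: d0 one_neq_zero not_False_eq_True)
  moreover have "?d * inverse ?d = 1" by (rule inverse_mult_eq_1') (simp only: d0 one_neq_zero not_False_eq_True)
  ultimately have eq: "euler_ratio (fps_X :: 'a fps) N n - 1 = ((?p N)\<^sup>2 - ?d) * inverse ?d"
    by (simp add: left_diff_distrib)
  have "fps_X ^ Suc (N - n) dvd ?p N - ?p (N - n)"
    by (rule power_dvd_euler_prod_diff) simp
  moreover have "fps_X ^ Suc (N - n) dvd ?p (N + n) - ?p N"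
  proof -
    have "(fps_X :: 'a fps) ^ Suc (N - n) dvd fps_X ^ Suc N" by (intro le_imp_power_dvd) simp
    then show ?thesis by (rule dvd_trans) (rule power_dvd_euler_prod_diff, simp)
  qed
  moreover have "(?p N)\<^sup>2 - ?d = (?p N - ?p (N - n)) * ?p N - (?p (N + n) - ?p N) * ?p (N - n)"
    by (simp add: power2_eq_square algebra_simps)
  ultimately show ?thesis unfolding eq by (metis dvd_diff dvd_mult2)
qed

lemma fps_nth_eqI_dvd:
  assumes "fps_X ^ k dvd f - (g :: 'a::comm_ring_1 fps)" "m < k"
  shows "fps_nth f m = fps_nth g m"
proof -
  obtain h where "f - g = fps_X ^ k * h" using assms(1) by (elim dvdE)
  then have "fps_nth (f - g) m = 0" using assms(2) by (simp add: fps_X_power_mult_nth)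
  then show ?thesis by simp
qed

lemma triangle_ge: "n \<le> triangle n"
  by (induction n) auto

lemma fps_geometric_X_power:
  fixes w :: "'a::field"
  assumes "n \<ge> 1"
  shows "Abs_fps (\<lambda>m. if n dvd m then w ^ (m div n) else 0) * (1 - fps_const w * fps_X ^ n) = 1"
    (is "?H * _ = 1")
proof (rule fps_ext)
  fix m
  have "fps_nth (?H * (1 - fps_const w * fps_X ^ n)) m
      = fps_nth ?H m - w * fps_nth (?H * fps_X ^ n) m"
    by (simp add: right_diff_distrib mult.left_commute)
  also have "\<dots> = fps_nth 1 m"
  proof (cases "m < n")
    case True
    then show ?thesis by (auto simp: fps_X_power_mult_right_nth dest: dvd_imp_le)
  next
    case False
    then obtain k where "m = n + k" using le_Suc_ex not_less by blast
    then show ?thesis using assms by (simp add: fps_X_power_mult_right_nth)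
  qed
  finally show "fps_nth (?H * (1 - fps_const w * fps_X ^ n)) m = fps_nth 1 m" .
qed

text \<open>The denominator is (1 - z t^n)(1 - t^n/z). The partial fractions over its two factors
  have numerators 1 - z and 1 - 1/z, and each expands as a geometric series in t^n.\<close>

lemma symmetric_geometric_fps:
  fixes z :: "'a::field"
  assumes "z \<noteq> 0" "n \<ge> 1"
  shows "fps_const (2 - (z + inverse z)) * (1 + fps_X ^ n)
           / (1 - fps_const (z + inverse z) * fps_X ^ n + fps_X ^ (2 * n))
       = Abs_fps (\<lambda>m. if n dvd m then (1 - z) * z ^ (m div n)
            + (1 - inverse z) * inverse z ^ (m div n) else 0)" (is "?A / ?D = ?G")
proof -
  define H where "H = (\<lambda>w::'a. Abs_fps (\<lambda>m. if n dvd m then w ^ (m div n) else 0))"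
  define X where "X = (fps_X ^ n :: 'a fps)"
  have X2: "fps_X ^ (2 * n) = X\<^sup>2" unfolding X_def by (metis power_mult mult.commute)
  define y where "y = fps_const z"
  define y' where "y' = fps_const (inverse z)"
  have yy: "y * y' = 1" unfolding y_def y'_def using assms(1) by simp
  have c: "fps_const (z + inverse z) = y + y'" "fps_const (2 - (z + inverse z)) = 2 - y - y'"
    by (simp_all add: y_def y'_def numeral_fps_const fps_const_sub [symmetric] del: fps_const_sub)
  have D: "?D = (1 - y * X) * (1 - y' * X)"
    unfolding c X2 X_def [symmetric] using yy by (simp add: algebra_simps power2_eq_square)
  have G: "?G = (1 - y) * H z + (1 - y') * H (inverse z)"
    unfolding y_def y'_def
    by (rule fps_ext) (simp add: H_def left_diff_distrib)
  have H: "H z * (1 - y * X) = 1" "H (inverse z) * (1 - y' * X) = 1"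
    unfolding H_def y_def y'_def X_def using fps_geometric_X_power assms(2) by blast+
  have "?G * ?D = (1 - y) * (1 - y' * X) * (H z * (1 - y * X))
      + (1 - y') * (1 - y * X) * (H (inverse z) * (1 - y' * X))"
    unfolding G D by (simp add: algebra_simps)
  also have "\<dots> = ?A"
    unfolding H c X_def [symmetric] using yy by (simp add: algebra_simps)
  finally have A: "?A = ?G * ?D" ..
  have "?D \<noteq> 0"
  proof -
    have "fps_nth ?D 0 = 1" using assms(2) by simp
    then show ?thesis by (metis fps_zero_nth zero_neq_one)
  qed
  then show ?thesis unfolding A by (rule fps_divide_times_eq)
qed

lemma fps_nth_prod_C_factor_eq:
  fixes z :: "'a::field"
  assumes "z \<noteq> 0" "m \<le> N"
  shows "fps_nth (\<Prod>i=1..N. (1 - fps_X ^ i)\<^sup>2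
            / (1 - fps_const (z + inverse z) * fps_X ^ i + fps_X ^ (2 * i))) m
       = (if m = 0 then 1 else 0) + (\<Sum>n=1..N. \<Sum>j\<le>m. if m = triangle n + n * j
            then (-1) ^ n * ((1 - z) * z ^ j + (1 - inverse z) * inverse z ^ j) else 0)"
proof -
  let ?c = "z + inverse z"
  define D where "D = (\<lambda>i. 1 - fps_const ?c * fps_X ^ i + fps_X ^ (2 * i))"
  define g where "g = (\<lambda>j. (1 - z) * z ^ j + (1 - inverse z) * inverse z ^ j)"
  have summand: "fps_nth (fps_const (2 - ?c) * ((-1) ^ n * fps_X ^ triangle n * (1 + fps_X ^ n)
              * euler_ratio fps_X N n / D n)) m
      = (\<Sum>j\<le>m. if m = triangle n + n * j then (-1) ^ n * g j else 0)" (is "fps_nth ?T m = _")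
    if n: "n \<in> {1..N}" for n
  proof -
    define G where "G = Abs_fps (\<lambda>m. if n dvd m then g (m div n) else 0)"
    have D0: "fps_nth (D n) 0 = 1" using n by (simp add: D_def)
    have G: "fps_const (2 - ?c) * (1 + fps_X ^ n) / D n = G"
      unfolding D_def G_def g_def by (rule symmetric_geometric_fps) (use assms n in auto)
    have "?T = (-1) ^ n * fps_X ^ triangle n * euler_ratio fps_X N n
          * (fps_const (2 - ?c) * (1 + fps_X ^ n) / D n)"
      using D0 by (simp add: fps_divide_unit mult_ac)
    also have "\<dots> = (-1) ^ n * fps_X ^ triangle n * euler_ratio fps_X N n * G"
      unfolding G ..
    finally have T: "?T = (-1) ^ n * fps_X ^ triangle n * euler_ratio fps_X N n * G" .
    have "fps_X ^ triangle n * fps_X ^ Suc (N - n) dvd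
        fps_X ^ triangle n * (euler_ratio fps_X N n - 1 :: 'a fps)"
      using n by (intro mult_dvd_mono X_power_dvd_euler_ratio_minus_1) auto
    \<comment> \<open>Since triangle n \<ge> n, the prefactor raises the error order from N - n + 1
      to at least N + 1, beyond the coefficient m \<le> N.\<close>
    moreover have "(fps_X :: 'a fps) ^ Suc N dvd fps_X ^ triangle n * fps_X ^ Suc (N - n)"
      unfolding power_add [symmetric] using n triangle_ge[of n] by (intro le_imp_power_dvd) auto
    ultimately have "fps_X ^ Suc N dvd fps_X ^ triangle n * (euler_ratio fps_X N n - 1 :: 'a fps)"
      by (rule dvd_trans [rotated])
    then have "fps_X ^ Suc N dvd
        ((-1) ^ n * G) * (fps_X ^ triangle n * (euler_ratio fps_X N n - 1))"
      by (rule dvd_mult)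
    then have "fps_X ^ Suc N dvd ?T - (-1) ^ n * (fps_X ^ triangle n * G)"
      unfolding T by (simp add: algebra_simps)
    then have "fps_nth ?T m = fps_nth ((-1) ^ n * (fps_X ^ triangle n * G)) m"
      using assms(2) by (intro fps_nth_eqI_dvd[of "Suc N"]) auto
    also have "(-1) ^ n * (fps_X ^ triangle n * G)
        = fps_const ((-1) ^ n) * (fps_X ^ triangle n * G)"
      by (simp add: fps_const_power [symmetric] fps_const_neg [symmetric]
          del: fps_const_power fps_const_neg)
    also have "fps_nth \<dots> m = (-1) ^ n * (if m < triangle n then 0 else fps_nth G (m - triangle n))"
      by (simp add: fps_X_power_mult_nth)
    also have "\<dots> = (\<Sum>j\<le>m. if m = triangle n + n * j then (-1) ^ n * g j else 0)"
    proof (cases "\<exists>j. m = triangle n + n * j")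
      case True
      then obtain j where j: "m = triangle n + n * j" by blast
      \<comment> \<open>As n \<ge> 1, the range j \<le> m misses no solution, and the solution j is
        unique.\<close>
      have "j \<le> n * j" using n by simp
      with j have jm: "j \<le> m" by linarith
      have "(\<Sum>i\<le>m. if m = triangle n + n * i then (-1) ^ n * g i else 0)
          = (\<Sum>i\<le>m. if i = j then (-1) ^ n * g i else 0)"
        using n by (intro sum.cong refl) (auto simp: j)
      then show ?thesis using j jm n by (simp add: G_def)
    next
      case False
      then have "\<not> n dvd m - triangle n" if "triangle n \<le> m"
        using that by (metis dvdE le_add_diff_inverse)
      with False show ?thesis by (simp add: G_def)
    qed
    finally show ?thesis .
  qed
  have "(\<Sum>n=1..N. fps_nth (fps_const (2 - ?c) * ((-1) ^ n * fps_X ^ triangle n * (1 + fps_X ^ n)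
              * euler_ratio fps_X N n / D n)) m)
      = (\<Sum>n=1..N. \<Sum>j\<le>m. if m = triangle n + n * j then (-1) ^ n * g j else 0)"
    by (rule sum.cong [OF refl summand])
  then show ?thesis
    unfolding prod_partial_fractions_fps D_def g_def sum_distrib_left fps_add_nth fps_sum_nth
    by (simp only: fps_one_nth)
qed

section \<open>Representations as sums of consecutive integers\<close>

text \<open>The number triangle k + k j is (j+1) + ... + (j+k). The bound \<open>Suc m\<close>
  matches the m + 1 factors kept in \<open>C_series_nth\<close>.\<close>

definition trapezoid_coeff :: "nat \<Rightarrow> nat \<Rightarrow> int" where
  "trapezoid_coeff m j = (\<Sum>k=1..Suc m. if m = triangle k + k * j then (-1) ^ k else 0)"

lemma two_triangle: "2 * triangle k = k * (k + 1)"
  by (simp add: triangle_def)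

lemma trapezoid_less:
  assumes "k < l"
  shows "triangle k + k * j < triangle l + l * j"
  using assms
proof (induction l rule: less_Suc_induct)
  case (1 l) then show ?case by simp
qed simp

lemma trapezoid_coeff_eq:
  assumes "k \<ge> 1" "m = triangle k + k * j"
  shows "trapezoid_coeff m j = (-1) ^ k"
proof -
  have "m = triangle l + l * j \<longleftrightarrow> l = k" for l
    using trapezoid_less[of k l j] trapezoid_less[of l k j] assms(2) by (cases k l rule: linorder_cases) auto
  then have "trapezoid_coeff m j = (\<Sum>l=1..Suc m. if l = k then (-1) ^ k else 0)"
    unfolding trapezoid_coeff_def by (intro sum.cong) auto
  moreover have "k \<le> m" using triangle_ge[of k] assms(2) by simp
  ultimately show ?thesis using assms(1) by simp
qed

lemma trapezoid_coeff_eq_0: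
  assumes "\<And>k. k \<ge> 1 \<Longrightarrow> m \<noteq> triangle k + k * j"
  shows "trapezoid_coeff m j = 0"
  unfolding trapezoid_coeff_def by (intro sum.neutral) (use assms in auto)

text \<open>The left side lies strictly between the values of l \<mapsto> triangle l + l j at l = k
  and l = k + 1. Hence the two nonzero cases of (b) exclude each other.\<close>

lemma trapezoid_interlace:
  assumes "k \<ge> 1"
  shows "triangle k + k * Suc j \<noteq> triangle l + l * j"
proof (cases "l \<le> k")
  case True
  then have "triangle l + l * j \<le> triangle k + k * j"
    using trapezoid_less[of l k j] by (cases "l = k") auto
  with assms show ?thesis by simp
next
  case False
  then have "triangle (Suc k) + Suc k * j \<le> triangle l + l * j"
    using trapezoid_less[of "Suc k" l j] by (cases "l = Suc k") auto
  then show ?thesis by simp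
qed

section \<open>The coefficients of C\<close>

text \<open>These are the coefficients produced by summation by parts; the 2 at i = 0 is q^0 +
  q^(-0).\<close>

definition C_coeff :: "nat \<Rightarrow> nat \<Rightarrow> int" where
  "C_coeff m i = (if i = 0 then 2 * trapezoid_coeff m 0 else trapezoid_coeff m i - trapezoid_coeff m (i - 1))"

lemma summation_by_parts_Suc:
  fixes e w :: "nat \<Rightarrow> 'a::comm_ring_1"
  shows "(\<Sum>j\<le>m. e j * (w j - w (Suc j)))
       = e 0 * w 0 + (\<Sum>i=1..m. (e i - e (i - 1)) * w i) - e m * w (Suc m)"
  by (induction m) (simp_all add: algebra_simps)

lemma C_eq:
  assumes "m \<ge> 1"
  shows "C m = of_int (C_coeff m 0) * q ^ m
           + (\<Sum>i=1..m. of_int (C_coeff m i) * (q ^ (m + i) + q ^ (m - i)))"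
proof -
  define w :: "nat \<Rightarrow> rat fls" where "w = (\<lambda>j. q ^ j + inverse q ^ j)"
  \<comment> \<open>The two geometric contributions combine into a difference of consecutive w,
    ready for summation by parts.\<close>
  have w: "(1 - q) * q ^ j + (1 - inverse q) * inverse q ^ j = w j - w (Suc j)" for j
    by (simp add: w_def algebra_simps)
  have "(\<Prod>i\<le>m. C_factor (Suc i)) = (\<Prod>i=1..Suc m. C_factor i)"
    by (rule prod.reindex_bij_witness[of _ "\<lambda>i. i - 1" Suc]) auto
  then have "fps_nth C_series m = fps_nth (\<Prod>i=1..Suc m. (1 - fps_X ^ i)\<^sup>2
            / (1 - fps_const (q + inverse q) * fps_X ^ i + fps_X ^ (2 * i))) m"
    by (simp only: C_series_nth C_factor_def)
  also have "\<dots> = (\<Sum>n=1..Suc m. \<Sum>j\<le>m. if m = triangle n + n * j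
            then (-1) ^ n * (w j - w (Suc j)) else 0)"
  proof -
    have "m \<noteq> 0" "m \<le> Suc m" using assms by auto
    then show ?thesis
      by (simp only: fps_nth_prod_C_factor_eq [OF fls_X_nonzero] w if_False add_0)
  qed
  also have "\<dots> = (\<Sum>j\<le>m. \<Sum>n=1..Suc m. if m = triangle n + n * j
            then (-1) ^ n * (w j - w (Suc j)) else 0)"
    by (rule sum.swap)
  also have "\<dots> = (\<Sum>j\<le>m. of_int (trapezoid_coeff m j) * (w j - w (Suc j)))"
    unfolding trapezoid_coeff_def of_int_sum sum_distrib_right by (intro sum.cong refl) auto
  also have "\<dots> = of_int (trapezoid_coeff m 0) * w 0
      + (\<Sum>i=1..m. (of_int (trapezoid_coeff m i) - of_int (trapezoid_coeff m (i - 1))) * w i)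
      - of_int (trapezoid_coeff m m) * w (Suc m)"
    by (rule summation_by_parts_Suc)
  \<comment> \<open>This removes the boundary term, which would have involved q^(m+1): k m +
    triangle k exceeds m for k \<ge> 1.\<close>
  also have "trapezoid_coeff m m = 0"
  proof (rule trapezoid_coeff_eq_0)
    fix k :: nat assume k: "k \<ge> 1"
    then have "m \<le> k * m" by simp
    with k triangle_ge[of k] show "m \<noteq> triangle k + k * m" by linarith
  qed
  finally have nth: "fps_nth C_series m = of_int (C_coeff m 0)
      + (\<Sum>i=1..m. of_int (C_coeff m i) * w i)"
    by (simp add: C_coeff_def w_def mult.commute)
  have "q ^ m * w i = q ^ (m + i) + q ^ (m - i)" if "i \<le> m" for i
  proof -
    have "q ^ m = q ^ (m - i) * q ^ i" using that by (simp add: power_add [symmetric])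
    moreover have "q ^ i * inverse q ^ i = 1"
      by (simp add: power_mult_distrib [symmetric] del: power_mult_distrib)
    ultimately have "q ^ m * inverse q ^ i = q ^ (m - i)" by (simp add: mult.assoc)
    then show ?thesis by (simp add: w_def distrib_left power_add)
  qed
  then have "(\<Sum>i=1..m. q ^ m * (of_int (C_coeff m i) * w i))
      = (\<Sum>i=1..m. of_int (C_coeff m i) * (q ^ (m + i) + q ^ (m - i)))"
    by (intro sum.cong refl) (simp add: mult.left_commute)
  then show ?thesis
    unfolding C_def nth by (simp add: distrib_left sum_distrib_left mult.commute)
qed

section \<open>Uniqueness of the coefficients and conclusion\<close>

text \<open>For i \<ge> 1 the power q^(m-i) lies below q^m, so only the term with i = j reaches
  q^(m+j). Thus the displayed form determines its coefficients.\<close>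

lemma palindromic_coeff_nth:
  fixes c :: "nat \<Rightarrow> int"
  assumes "j \<le> m"
  shows "fls_nth (of_int (c 0) * q ^ m + (\<Sum>i=1..m. of_int (c i) * (q ^ (m + i) + q ^ (m - i))))
           (int (m + j)) = of_int (c j)"
proof -
  have "fls_nth (of_int (c i) * (q ^ (m + i) + q ^ (m - i))) (int (m + j))
      = (if i = j then of_int (c i) else 0)" if "i \<in> {1..m}" for i
    using that by (auto simp: fls_of_int)
  then have "(\<Sum>i=1..m. fls_nth (of_int (c i) * (q ^ (m + i) + q ^ (m - i))) (int (m + j)))
      = (\<Sum>i=1..m. if i = j then of_int (c i) else 0)"
    by (rule sum.cong [OF refl])
  also have "\<dots> = (if j = 0 then 0 else of_int (c j))"
    using assms by auto
  finally have "(\<Sum>i=1..m. fls_nth (of_int (c i) * (q ^ (m + i) + q ^ (m - i))) (int (m + j)))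
      = (if j = 0 then 0 else of_int (c j))" .
  moreover have "fls_nth (of_int (c 0) * q ^ m) (int (m + j)) = (if j = 0 then of_int (c 0) else 0)"
    by (auto simp: fls_of_int)
  ultimately show ?thesis
    unfolding fls_plus_nth fls_nth_sum by simp
qed

theorem theorem1p1:
  fixes n :: nat
  assumes "n \<ge> 1"
  shows
    "(\<exists>c :: nat \<Rightarrow> int.
        C n = of_int (c 0) * q ^ n + (\<Sum>i=1..n. of_int (c i) * (q ^ (n + i) + q ^ (n - i))))
   \<and> (\<forall>c :: nat \<Rightarrow> int.
        C n = of_int (c 0) * q ^ n + (\<Sum>i=1..n. of_int (c i) * (q ^ (n + i) + q ^ (n - i))) \<longrightarrow>
          (\<forall>k\<ge>1. 2 * n = k * (k + 1) \<longrightarrow> c 0 = 2 * (-1) ^ k)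
        \<and> ((\<nexists>k. k \<ge> 1 \<and> 2 * n = k * (k + 1)) \<longrightarrow> c 0 = 0)
        \<and> (\<forall>i. 1 \<le> i \<and> i \<le> n \<longrightarrow>
              (\<forall>k\<ge>1. 2 * n = k * (k + 2 * i + 1) \<longrightarrow> c i = (-1) ^ k)
            \<and> (\<forall>k\<ge>1. 2 * n = k * (k + 2 * i - 1) \<longrightarrow> c i = (-1) ^ (k - 1))
            \<and> ((\<nexists>k. k \<ge> 1 \<and> (2 * n = k * (k + 2 * i + 1) \<or> 2 * n = k * (k + 2 * i - 1)))
                 \<longrightarrow> c i = 0)))"
proof (intro conjI allI impI)
  show "\<exists>c :: nat \<Rightarrow> int.
      C n = of_int (c 0) * q ^ n + (\<Sum>i=1..n. of_int (c i) * (q ^ (n + i) + q ^ (n - i)))"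
    using C_eq[OF assms] by blast
next
  fix c :: "nat \<Rightarrow> int"
  assume c: "C n = of_int (c 0) * q ^ n + (\<Sum>i=1..n. of_int (c i) * (q ^ (n + i) + q ^ (n - i)))"
  have ceq: "c i = C_coeff n i" if "i \<le> n" for i
  proof -
    have "of_int (c i) = (of_int (C_coeff n i) :: rat)"
      using palindromic_coeff_nth[OF that, of c] palindromic_coeff_nth[OF that, of "C_coeff n"]
        c C_eq[OF assms] by metis
    then show ?thesis by simp
  qed
  have iff0: "2 * n = k * (k + 2 * i + 1) \<longleftrightarrow> n = triangle k + k * i" for k i
    using two_triangle[of k] by (auto simp: algebra_simps)
  \<comment> \<open>The second case for i is the first case for i - 1; i \<ge> 1 keeps the truncated
    subtraction exact.\<close>
  have iff1: "2 * n = k * (k + 2 * Suc j - 1) \<longleftrightarrow> n = triangle k + k * j" for k j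
    using iff0[of k j] by simp
  have iff: "2 * n = k * (k + 1) \<longleftrightarrow> n = triangle k + k * 0" for k
    using iff0[of k 0] by simp
  { fix k :: nat
    assume "k \<ge> 1" "2 * n = k * (k + 1)"
    then show "c 0 = 2 * (-1) ^ k"
      using iff[of k] trapezoid_coeff_eq[of k n 0] by (simp add: ceq C_coeff_def) }
  { assume "\<nexists>k. k \<ge> 1 \<and> 2 * n = k * (k + 1)"
    then have "trapezoid_coeff n 0 = 0" unfolding iff by (intro trapezoid_coeff_eq_0) blast
    then show "c 0 = 0" by (simp add: ceq C_coeff_def) }
  fix i assume "1 \<le> i \<and> i \<le> n"
  then obtain j where j: "i = Suc j" "c i = trapezoid_coeff n i - trapezoid_coeff n j"
    by (cases i) (auto simp: ceq C_coeff_def)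
  { fix k :: nat
    assume k: "k \<ge> 1" "2 * n = k * (k + 2 * i + 1)"
    then have n: "n = triangle k + k * i" by (simp only: iff0)
    then have "trapezoid_coeff n j = 0"
      using trapezoid_interlace[OF k(1), of j] j(1) by (intro trapezoid_coeff_eq_0) simp
    then show "c i = (-1) ^ k" using trapezoid_coeff_eq[OF k(1) n] j by simp }
  { fix k :: nat
    assume k: "k \<ge> 1" "2 * n = k * (k + 2 * i - 1)"
    then have n: "n = triangle k + k * j" by (simp only: iff1 j(1))
    have "trapezoid_coeff n i = 0"
    proof (rule trapezoid_coeff_eq_0)
      fix l :: nat assume "l \<ge> 1"
      then show "n \<noteq> triangle l + l * i"
        using trapezoid_interlace[of l j k] n j(1) by metis
    qed
    moreover have "(-1 :: int) ^ (k - 1) = - ((-1) ^ k)" using k(1) by (cases k) auto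
    ultimately show "c i = (-1) ^ (k - 1)" using trapezoid_coeff_eq[OF k(1) n] j by simp }
  { assume none: "\<nexists>k. k \<ge> 1 \<and> (2 * n = k * (k + 2 * i + 1) \<or> 2 * n = k * (k + 2 * i - 1))"
    have "trapezoid_coeff n i = 0" "trapezoid_coeff n j = 0"
      using none unfolding iff0 j(1) iff1 by (auto intro!: trapezoid_coeff_eq_0)
    then show "c i = 0" using j by simp }
qed

end
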